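(* Let $n>0$ be an integer and let $\alpha\in\mathbb{R}_{>0}$ satisfy at least one of the following conditions: (i) $\alpha^2\notin\mathbb{Q}$; (ii) $\alpha^2=p/q$ with $p,q\in\mathbb{N}$ and $47\nmid q$; (iii) $\alpha^2\ge 2$; (iv) $\alpha^2\le 1/(7\cdot 47^4\cdot 48)$. Then there exists a red/blue-coloring of $\mathbb{E}^n$ that contains no red copy of $\ell_3$ and no blue copy of $\alpha\ell_{8649}$.
   Context: $\mathbb{E}^n$ denotes $\mathbb{R}^n$ with the Euclidean distance. For $\alpha>0$ and an integer $m>0$, $\alpha\ell_m$ denotes a set of $m$ collinear points such that consecutive points are at distance $\alpha$; $\ell_m=1\ell_m$. A copy of a set is a congruent copy (image under an isometry of $\mathbb{E}^n$). A red (resp. blue) copy is a copy all of whose points are red (resp. blue). *)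

theory Defs
  imports "HOL-Analysis.Analysis"
begin

(* Surjectivity is not required: on a Euclidean space it follows from preservation of distances. *)
definition isometry :: "('a::metric_space \<Rightarrow> 'a) \<Rightarrow> bool" where
  "isometry f \<longleftrightarrow> (\<forall>x y. dist (f x) (f y) = dist x y)"

definition is_copy :: "'a::metric_space set \<Rightarrow> 'a set \<Rightarrow> bool" where
  "is_copy S T \<longleftrightarrow> (\<exists>f. isometry f \<and> T = f ` S)"

(* m collinear points with consecutive points at distance a, listed in their order along the
   line: p is the first point and the unit vector u is the direction of the line. *)
definition is_ell :: "real \<Rightarrow> nat \<Rightarrow> 'a::real_normed_vector set \<Rightarrow> bool" where
  "is_ell a m S \<longleftrightarrow>
     (\<exists>p u. norm u = 1 \<and> S = (\<lambda>k. p + (real k * a) *\<^sub>R u) ` {..<m})"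

datatype colour = Red | Blue

definition has_mono_copy ::
    "('a::real_normed_vector \<Rightarrow> colour) \<Rightarrow> colour \<Rightarrow> real \<Rightarrow> nat \<Rightarrow> bool" where
  "has_mono_copy c col a m \<longleftrightarrow>
     (\<exists>S T. is_ell a m S \<and> is_copy S T \<and> (\<forall>x\<in>T. c x = col))"

lemma is_ell_card:
  assumes "is_ell a m S" "a > 0"
  shows "card S = m"
proof -
  obtain p u where u: "norm u = 1" and S: "S = (\<lambda>k. p + (real k * a) *\<^sub>R u) ` {..<m}"
    using assms(1) unfolding is_ell_def by blast
  have "u \<noteq> 0" using u by auto
  then have "inj_on (\<lambda>k. p + (real k * a) *\<^sub>R u) {..<m}"
    using assms(2) by (auto simp: inj_on_def)
  then show ?thesis unfolding S by (simp add: card_image)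
qed

end

theory Submission
  imports Defs "HOL-Number_Theory.Cong"
begin

text \<open>Colour \<open>x\<close> red iff \<open>frac (\<mu> * (norm x)\<^sup>2) < 6 / 47\<close>. Along three equally spaced points at
  distance 1, \<open>(norm x)\<^sup>2\<close> has second difference 2, so \<open>\<ell>\<^sub>3\<close> cannot be red once \<open>2 * \<mu>\<close> is at
  distance at least \<open>12 / 47\<close> from the integers. Along a copy of \<open>\<alpha>\<ell>\<^sub>m\<close>, \<open>47 * \<mu> * (norm x)\<^sup>2\<close> is a
  quadratic sequence with leading coefficient \<open>47 * \<mu> * \<alpha>\<^sup>2\<close>; the hypotheses on \<open>\<alpha>\<close> allow \<open>\<mu>\<close> to be
  chosen so that this is very close to an integer prime to 47. By Dirichlet some step \<open>D \<le> 125\<close> makes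
  the linear coefficient nearly integral, so on 47 terms with step \<open>D\<close> the sequence is, up to an
  error below 1/2, a constant plus an integral quadratic that is not constant modulo 47. Since among any
  five consecutive residues modulo 47 there is one of the form \<open>z\<^sup>2\<close> and one of the form \<open>- z\<^sup>2\<close>,
  that quadratic falls into any given window of five residues, which makes some term red.\<close>

section \<open>Copies of equally spaced points\<close>

lemma isometry_image_ell:
  fixes p u :: "'a::real_inner"
  assumes f: "isometry f" and u: "norm u = 1" and a: "a \<ge> 0"
  obtains x v where "norm v = a" "\<And>k::nat. f (p + (real k * a) *\<^sub>R u) = x + real k *\<^sub>R v"
proof -
  define y where "y k = f (p + (real k * a) *\<^sub>R u)" for k :: nat
  define v where "v = y 1 - y 0"
  have d: "norm (y k - y l) = \<bar>real k - real l\<bar> * a" for k l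
  proof -
    have "norm (y k - y l) = dist (p + (real k * a) *\<^sub>R u) (p + (real l * a) *\<^sub>R u)"
      using f by (simp add: y_def isometry_def flip: dist_norm)
    also have "\<dots> = norm ((real k * a - real l * a) *\<^sub>R u)"
      by (simp add: dist_norm algebra_simps)
    also have "\<dots> = \<bar>real k - real l\<bar> * a"
      using u a by (simp add: abs_mult flip: left_diff_distrib)
    finally show ?thesis .
  qed
  have v: "norm v = a"
    using d[of 1 0] by (simp add: v_def)
  have "y k = y 0 + real k *\<^sub>R v" for k
  proof -
    define w where "w = y k - y 0"
    have 1: "w \<bullet> w = (real k * a)\<^sup>2" "v \<bullet> v = a\<^sup>2"
      using d[of k 0] v by (simp_all add: w_def dot_square_norm)
    have "norm (w - v) = \<bar>real k - 1\<bar> * a"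
      using d[of k 1] by (simp add: w_def v_def)
    then have "(w - v) \<bullet> (w - v) = (real k - 1)\<^sup>2 * a\<^sup>2"
      by (simp add: dot_square_norm power_mult_distrib)
    then have 2: "w \<bullet> v = real k * a\<^sup>2"
      using 1 by (simp add: inner_diff_left inner_diff_right inner_commute algebra_simps power2_eq_square)
    \<comment> \<open>Equality case of Cauchy-Schwarz: distances to the first two image points fix
      \<open>w \<bullet> w\<close> and \<open>w \<bullet> v\<close>, which forces this square to
      vanish.\<close>
    have "(w - real k *\<^sub>R v) \<bullet> (w - real k *\<^sub>R v)
        = w \<bullet> w - 2 * real k * (w \<bullet> v) + (real k)\<^sup>2 * (v \<bullet> v)"
      by (simp add: inner_diff_left inner_diff_right inner_commute algebra_simps power2_eq_square)
    also have "\<dots> = 0"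
      unfolding 1 2 by (simp add: power2_eq_square algebra_simps)
    finally have "w - real k *\<^sub>R v = 0"
      by (simp only: inner_eq_zero_iff)
    then show ?thesis
      by (simp add: w_def algebra_simps)
  qed
  with v show ?thesis
    using that[of v "y 0"] unfolding y_def by blast
qed

lemma has_mono_copyE:
  fixes c :: "'a::real_inner \<Rightarrow> colour"
  assumes "has_mono_copy c col a m" "a \<ge> 0"
  obtains x v where "norm v = a" "\<And>k. k < m \<Longrightarrow> c (x + real k *\<^sub>R v) = col"
proof -
  obtain f p u where f: "isometry f" and u: "norm u = 1"
    and c: "\<forall>k\<in>{..<m}. c (f (p + (real k * a) *\<^sub>R u)) = col"
    using assms(1) unfolding has_mono_copy_def is_ell_def is_copy_def by auto
  from isometry_image_ell[OF f u assms(2), of p] show ?thesis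
    using c that by (metis lessThan_iff)
qed

lemma norm_sq_line:
  fixes x v :: "'a::real_inner"
  shows "(norm (x + k *\<^sub>R v))\<^sup>2 = (norm x)\<^sup>2 + 2 * (x \<bullet> v) * k + (norm v)\<^sup>2 * k\<^sup>2"
  unfolding power2_norm_eq_inner
  by (simp add: inner_add_left inner_add_right inner_commute algebra_simps power2_eq_square)

section \<open>Quadratic polynomials modulo 47\<close>

lemma multiple_of_square_47:
  fixes c :: int
  assumes "\<not> 47 dvd c"
  obtains y s where "s = 1 \<or> s = - 1" "[c * y\<^sup>2 = s] (mod 47)"
proof -
  \<comment> \<open>As 47 is 3 modulo 4, -1 is a non-residue, so one of \<open>d\<close> and
    \<open>- d\<close> is a nonzero square; 46 stands for -1.\<close>
  have *: "\<forall>d\<in>set [1..46]. \<exists>y\<in>set [1..46]. (d * (y * y)) mod 47 = 1 \<or> (d * (y * y)) mod 47 = (46::int)"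
    by code_simp
  have "c mod 47 \<in> set [1..46]"
    using assms by (simp add: dvd_eq_mod_eq_0) (smt (verit) pos_mod_bound pos_mod_sign)
  then obtain y where "(c mod 47 * (y * y)) mod 47 = 1 \<or> (c mod 47 * (y * y)) mod 47 = 46"
    using * by blast
  then have "(c * y\<^sup>2) mod 47 = 1 \<or> (c * y\<^sup>2) mod 47 = 46"
    by (simp add: mod_mult_left_eq power2_eq_square)
  then have "[c * y\<^sup>2 = 1] (mod 47) \<or> [c * y\<^sup>2 = - 1] (mod 47)"
    by (auto simp: cong_def)
  then show ?thesis using that by blast
qed

lemma square_in_window_47:
  fixes s u :: int
  assumes "s = 1 \<or> s = - 1"
  obtains z where "(s * z\<^sup>2 - u) mod 47 \<le> 4"
proof -
  \<comment> \<open>The longest runs of non-squares modulo 47, such as 38 to 41, have length 4;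
    hence windows of five residues.\<close>
  have *: "\<forall>s\<in>set [1,-1]. \<forall>w\<in>set [0..46]. \<exists>z\<in>set [0..46]. (s * (z * z) - w) mod 47 \<le> (4::int)"
    by code_simp
  have "u mod 47 \<in> set [0..46]"
    by simp
  then obtain z where "(s * (z * z) - u mod 47) mod 47 \<le> 4"
    using * assms by fastforce
  then show ?thesis
    using that by (simp add: mod_diff_right_eq power2_eq_square)
qed

text \<open>If 47 divides \<open>c\<close>, the polynomial is linear and invertible modulo 47.
  Otherwise rescaling the variable makes the leading coefficient 1 or -1, and completing the square
  reduces to a shifted window for \<open>s * z\<^sup>2\<close>.\<close>

lemma quadratic_in_window_47:
  fixes b c u :: int
  assumes "\<not> (47 dvd b \<and> 47 dvd c)"
  obtains k where "0 \<le> k" "k < 47" "(c * k\<^sup>2 + b * k - u) mod 47 \<le> 4"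
proof -
  have "\<exists>k. (c * k\<^sup>2 + b * k - u) mod 47 \<le> 4"
  proof (cases "47 dvd c")
    case True
    then have "\<not> 47 dvd b" using assms by simp
    moreover have "prime (47::int)" by (simp add: prime_int_numeral_eq)
    ultimately have "coprime b 47"
      using prime_imp_coprime coprime_commute by blast
    then obtain x where x: "[b * x = 1] (mod 47)"
      using cong_solve_coprime_int by blast
    have "[c * (x * u)\<^sup>2 + (b * x) * u - u = 0 * (x * u)\<^sup>2 + 1 * u - u] (mod 47)"
      using True x by (intro cong_diff cong_add cong_mult cong_refl) (simp_all add: cong_0_iff)
    then have "(c * (x * u)\<^sup>2 + b * (x * u) - u) mod 47 = 0"
      by (simp add: cong_def mult.assoc)
    then show ?thesis
      by (intro exI[of _ "x * u"]) simp
  next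
    case False
    then obtain y s where s: "s = 1 \<or> s = - 1" and y: "[c * y\<^sup>2 = s] (mod 47)"
      by (rule multiple_of_square_47)
    \<comment> \<open>completing the square, with \<open>24\<close> as inverse of \<open>2\<close>\<close>
    define e where "e = 24 * s * b * y"
    obtain z where z: "(s * z\<^sup>2 - (u + s * e\<^sup>2)) mod 47 \<le> 4"
      using square_in_window_47[OF s] by blast
    have ss: "s * s = 1" using s by auto
    have "2 * s * e - s * s * b * y = 47 * (s * s * b * y)"
      by (simp add: e_def)
    then have se: "[s * s * b * y = 2 * s * e] (mod 47)"
      by (metis cong_iff_dvd_diff cong_sym dvd_triv_left)
    have "[c * (y * (z - e))\<^sup>2 + b * (y * (z - e)) - u
         = (c * y\<^sup>2) * (z - e)\<^sup>2 + (s * s * b * y) * (z - e) - u] (mod 47)"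
      unfolding ss by (simp add: power2_eq_square algebra_simps)
    also have "[(c * y\<^sup>2) * (z - e)\<^sup>2 + (s * s * b * y) * (z - e) - u
         = s * (z - e)\<^sup>2 + (2 * s * e) * (z - e) - u] (mod 47)"
      by (intro cong_diff cong_add cong_mult[OF y cong_refl] cong_mult[OF se cong_refl] cong_refl)
    also have "s * (z - e)\<^sup>2 + (2 * s * e) * (z - e) - u = s * z\<^sup>2 - (u + s * e\<^sup>2)"
      by (simp add: power2_eq_square algebra_simps)
    finally show ?thesis
      using z by (metis cong_def)
  qed
  then obtain k where k: "(c * k\<^sup>2 + b * k - u) mod 47 \<le> 4" by blast
  have "[c * (k mod 47)\<^sup>2 + b * (k mod 47) - u = c * k\<^sup>2 + b * k - u] (mod 47)"
    by (intro cong_diff cong_add cong_mult cong_pow cong_refl) simp_all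
  with k have "(c * (k mod 47)\<^sup>2 + b * (k mod 47) - u) mod 47 \<le> 4"
    by (simp add: cong_def)
  then show ?thesis
    by (intro that[of "k mod 47"]) simp_all
qed

section \<open>From residues to fractional parts\<close>

lemma frac_window_47:
  assumes "(n - m) mod 47 \<le> 4" "0 \<le> y + of_int m" "y + of_int m < 2"
  shows "frac ((y + of_int n) / 47) < 6 / (47::real)"
proof -
  define r q where "r = (n - m) mod 47" and "q = (n - m) div 47"
  have n: "n = 47 * q + r + m" and r: "0 \<le> r" "r \<le> 4"
    using assms(1) by (simp_all add: r_def q_def)
  have eq: "(y + of_int n) / 47 = (y + of_int m + of_int r) / 47 + of_int q"
    by (simp add: n field_simps)
  have "frac ((y + of_int n) / 47) = frac ((y + of_int m + of_int r) / 47)"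
    unfolding eq by simp
  \<comment> \<open>The numerator lies in [0, 6): at most 4 from the residue, less than 2 from the
    real offset.\<close>
  also have "\<dots> = (y + of_int m + of_int r) / 47"
    using assms r by (subst frac_eq) auto
  also have "\<dots> < 6 / 47"
    using assms r by simp
  finally show ?thesis .
qed

lemma quadratic_sequence_frac:
  fixes A \<beta> \<gamma> :: real
  assumes j: "\<not> 47 dvd j" and \<gamma>: "\<bar>\<gamma> - of_int j\<bar> \<le> 1 / (8 * 7 * 47 ^ 4)"
  obtains i :: nat where "i < 8649" "frac ((A + \<beta> * i + \<gamma> * i\<^sup>2) / 47) < 6 / 47"
proof -
  obtain a D where "coprime a D" and D: "0 < D" "D \<le> int 125"
    and b: "\<bar>of_int D * \<beta> - of_int a\<bar> < 1 / real 125"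
    using Dirichlet_approx_coprime[of 125 \<beta>] by auto
  have "prime (47::int)" by (simp add: prime_int_numeral_eq)
  \<comment> \<open>If 47 divides \<open>D\<close>, the quadratic coefficient vanishes modulo 47,
    but then coprimality keeps the linear one alive.\<close>
  then have "\<not> (47 dvd a \<and> 47 dvd j * D\<^sup>2)"
    using j \<open>coprime a D\<close>
    by (metis coprime_common_divisor not_prime_unit prime_dvd_mult_iff prime_dvd_power)
  \<comment> \<open>This puts \<open>A + u\<close> in [1/2, 3/2), so an error below 1/2 keeps the
    sum in (0, 2).\<close>
  define u where "u = \<lceil>1/2 - A\<rceil>"
  obtain k where k: "0 \<le> k" "k < 47" and n: "(j * D\<^sup>2 * k\<^sup>2 + a * k - u) mod 47 \<le> 4"
    using quadratic_in_window_47 \<open>\<not> (47 dvd a \<and> 47 dvd j * D\<^sup>2)\<close> by blast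
  define E where "E = (of_int D * \<beta> - of_int a) * of_int k + (\<gamma> - of_int j) * (of_int (D * k))\<^sup>2"
  have E: "\<bar>E\<bar> < 1/2"
  proof -
    \<comment> \<open>The linear error is at most 46/125 = 0.368, the quadratic one about 0.121 at
      most.\<close>
    have "\<bar>(of_int D * \<beta> - of_int a) * of_int k\<bar> \<le> (1 / 125) * 46"
      unfolding abs_mult using b k by (intro mult_mono) auto
    moreover have "D * k \<le> 125 * 46"
      using D k by (intro mult_mono) auto
    then have "(of_int (D * k))\<^sup>2 \<le> (real_of_int (125 * 46))\<^sup>2"
      using D k by (intro power_mono) (simp_all only: of_int_le_iff, simp)
    then have "\<bar>(\<gamma> - of_int j) * (of_int (D * k))\<^sup>2\<bar> \<le> 1 / (8 * 7 * 47 ^ 4) * (real_of_int (125 * 46))\<^sup>2"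
      unfolding abs_mult using \<gamma> by (intro mult_mono) auto
    ultimately show ?thesis
      using abs_triangle_ineq[of "(of_int D * \<beta> - of_int a) * of_int k" "(\<gamma> - of_int j) * (of_int (D * k))\<^sup>2"]
      unfolding E_def by simp
  qed
  define i where "i = nat (D * k)"
  have i: "real i = of_int (D * k)"
    using D k by (simp add: i_def)
  have "D * k \<le> 125 * 46"
    using D k by (intro mult_mono) auto
  then have "i < 8649"
    by (simp add: i_def)
  moreover have "A + \<beta> * i + \<gamma> * i\<^sup>2 = (A + E) + of_int (j * D\<^sup>2 * k\<^sup>2 + a * k)"
    by (simp add: i E_def power2_eq_square algebra_simps)
  moreover have "frac ((A + E + of_int (j * D\<^sup>2 * k\<^sup>2 + a * k)) / 47) < 6 / 47"
    using E ceiling_correct[of "1/2 - A", folded u_def]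
    by (intro frac_window_47[OF n]) linarith+
  ultimately show ?thesis
    using that by metis
qed

section \<open>The colouring obtained from a suitable scale\<close>

lemma frac_second_difference:
  fixes x y z d r :: real
  assumes "frac x < r" "frac y < r" "frac z < r" "x + z - 2 * y = d"
    and "2 * r \<le> frac d" "frac d \<le> 1 - 2 * r"
  shows False
proof -
  define m where "m = \<lfloor>x\<rfloor> + \<lfloor>z\<rfloor> - 2 * \<lfloor>y\<rfloor> - \<lfloor>d\<rfloor>"
  have "of_int m = frac d - frac x - frac z + 2 * frac y"
    using assms(4) by (simp add: m_def frac_def)
  moreover have "0 \<le> frac x" "0 \<le> frac y" "0 \<le> frac z" by simp_all
  \<comment> \<open>Below: \<open>frac x + frac z < 2 * r \<le> frac d\<close>. Above:
    \<open>2 * frac y < 2 * r \<le> 1 - frac d\<close>.\<close>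
  ultimately have "0 < real_of_int m" "real_of_int m < 1"
    using assms by linarith+
  then show False by simp
qed

text \<open>Here \<open>s\<close> stands for the square of \<alpha>. The window for
  \<open>2 * \<mu>\<close> is that of \<open>frac_second_difference\<close> with
  \<open>r = 6 / 47\<close>; the last condition feeds
  \<open>quadratic_sequence_frac\<close>.\<close>

definition admissible_scale :: "real \<Rightarrow> real \<Rightarrow> bool" where
  "admissible_scale s \<mu> \<longleftrightarrow> 12 / 47 \<le> frac (2 * \<mu>) \<and> frac (2 * \<mu>) \<le> 35 / 47 \<and>
     (\<exists>j::int. \<not> 47 dvd j \<and> \<bar>47 * \<mu> * s - of_int j\<bar> \<le> 1 / (8 * 7 * 47 ^ 4))"

lemma colouring_from_admissible_scale:
  assumes "admissible_scale (\<alpha>\<^sup>2) \<mu>" "\<alpha> > 0"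
  shows "\<exists>c :: 'a::real_inner \<Rightarrow> colour. \<not> has_mono_copy c Red 1 3 \<and> \<not> has_mono_copy c Blue \<alpha> 8649"
proof -
  define c :: "'a \<Rightarrow> colour" where "c x = (if frac (\<mu> * (norm x)\<^sup>2) < 6 / 47 then Red else Blue)" for x
  have "\<not> has_mono_copy c Red 1 3"
  proof
    assume "has_mono_copy c Red 1 3"
    then obtain x v where v: "norm v = 1" and c: "\<And>k. k < 3 \<Longrightarrow> c (x + real k *\<^sub>R v) = Red"
      by (rule has_mono_copyE) auto
    define t where "t k = \<mu> * (norm (x + real k *\<^sub>R v))\<^sup>2" for k
    have "frac (t k) < 6 / 47" if "k < 3" for k
      using c[OF that] by (auto simp: c_def t_def split: if_splits)
    moreover have "t 0 + t 2 - 2 * t 1 = 2 * \<mu>"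
      unfolding t_def norm_sq_line v by (simp add: algebra_simps)
    ultimately show False
      using assms(1) frac_second_difference[of "t 0" "6/47" "t 1" "t 2" "2 * \<mu>"]
      by (simp add: admissible_scale_def)
  qed
  moreover have "\<not> has_mono_copy c Blue \<alpha> 8649"
  proof
    assume "has_mono_copy c Blue \<alpha> 8649"
    then obtain x v where v: "norm v = \<alpha>" and c: "\<And>k. k < 8649 \<Longrightarrow> c (x + real k *\<^sub>R v) = Blue"
      using assms(2) by (metis has_mono_copyE less_imp_le)
    obtain j where "\<not> 47 dvd j" "\<bar>47 * \<mu> * \<alpha>\<^sup>2 - of_int j\<bar> \<le> 1 / (8 * 7 * 47 ^ 4)"
      using assms(1) by (auto simp: admissible_scale_def)
    then obtain i :: nat where i: "i < 8649" and
      "frac ((47 * \<mu> * (norm x)\<^sup>2 + 47 * \<mu> * (2 * (x \<bullet> v)) * i + 47 * \<mu> * \<alpha>\<^sup>2 * i\<^sup>2) / 47) < 6 / 47"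
      by (rule quadratic_sequence_frac)
    moreover have "(47 * \<mu> * (norm x)\<^sup>2 + 47 * \<mu> * (2 * (x \<bullet> v)) * i + 47 * \<mu> * \<alpha>\<^sup>2 * i\<^sup>2) / 47
        = \<mu> * (norm (x + real i *\<^sub>R v))\<^sup>2"
      unfolding norm_sq_line v by (simp add: algebra_simps)
    ultimately have "c (x + real i *\<^sub>R v) = Red"
      by (simp add: c_def)
    with c[OF i] show False by simp
  qed
  ultimately show ?thesis by blast
qed

section \<open>Choosing the scale in the four cases\<close>

lemma admissible_scale_irrational:
  assumes "s \<notin> \<rat>"
  shows "\<exists>\<mu>. admissible_scale s \<mu>"
proof -
  have "s / 2 \<notin> \<rat>"
  proof
    assume "s / 2 \<in> \<rat>"
    then have "2 * (s / 2) \<in> \<rat>" by (intro Rats_mult) auto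
    with assms show False by simp
  qed
  define \<epsilon> :: real where "\<epsilon> = 1 / (8 * 7 * 47 ^ 4) / 47"
  have "\<epsilon> > 0" by (simp add: \<epsilon>_def)
  \<comment> \<open>For \<open>\<mu> = k / 2 + 1 / 4\<close> the window condition holds for every
    integer \<open>k\<close>; density modulo 1 brings \<open>\<mu> * s\<close> near
    \<open>h + 1 / 47\<close>.\<close>
  obtain h k where
    hk: "\<bar>of_int k * (s / 2) - of_int h - (1 / 47 - s / 4)\<bar> < \<epsilon>"
    using sequence_of_fractional_parts_is_dense[OF \<open>s / 2 \<notin> \<rat>\<close> \<open>\<epsilon> > 0\<close>, of "1 / 47 - s / 4"] by blast
  define \<mu> where "\<mu> = (of_int k + 1 / 2) / (2::real)"
  have \<mu>: "2 * \<mu> = 1 / 2 + real_of_int k"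
    by (simp add: \<mu>_def)
  have "frac (2 * \<mu>) = 1 / 2"
    unfolding \<mu> by (simp add: frac_eq)
  moreover have "47 * \<mu> * s - of_int (47 * h + 1) = 47 * (of_int k * (s / 2) - of_int h - (1 / 47 - s / 4))"
    by (simp add: \<mu>_def field_simps)
  then have "\<bar>47 * \<mu> * s - of_int (47 * h + 1)\<bar> \<le> 47 * \<epsilon>"
    using hk by (simp add: abs_mult)
  moreover have "\<not> 47 dvd 47 * h + 1"
    by presburger
  ultimately show ?thesis
    unfolding admissible_scale_def \<epsilon>_def by (intro exI[of _ \<mu>] conjI exI[of _ "47 * h + 1"]) auto
qed

text \<open>The choice \<open>\<mu> = j / (47 * s)\<close> makes the leading coefficient exactly
  \<open>j\<close>, leaving only the window to check.\<close>

lemma admissible_scale_exact: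
  assumes "s > 0" "\<not> 47 dvd j" "12 / 47 \<le> frac (2 * of_int j / (47 * s))" "frac (2 * of_int j / (47 * s)) \<le> 35 / 47"
  shows "\<exists>\<mu>. admissible_scale s \<mu>"
  using assms unfolding admissible_scale_def
  by (intro exI[of _ "of_int j / (47 * s)"] conjI exI[of _ j]) simp_all

text \<open>With \<open>p = 47 ^ e * p'\<close> and \<open>j\<close> a multiple of
  \<open>p'\<close>, the number \<open>2 * j / (47 * s)\<close> has denominator dividing
  \<open>M = 47 ^ (e + 1)\<close>. Since \<open>2 * q\<close> is invertible modulo \<open>M\<close>,
  its numerator can be given any residue, here \<open>u\<close>.\<close>

lemma admissible_scale_rational:
  fixes p q :: nat
  assumes "s > 0" "s = real p / real q" "q > 0" "\<not> 47 dvd q"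
  shows "\<exists>\<mu>. admissible_scale s \<mu>"
proof -
  have p47: "prime (47::nat)" by (simp add: prime_nat_numeral_eq)
  have "p \<noteq> 0" using assms(1,2) by (cases "p = 0") auto
  then obtain e p' where p: "p = 47 ^ e * p'" and p': "\<not> 47 dvd p'"
    using prime_power_canonical[OF p47] by (metis gr0I mult.commute)
  define M :: int where "M = 47 ^ (e + 1)"
  have "coprime q 47"
    using prime_imp_coprime[OF p47 assms(4)] by (simp add: coprime_commute)
  then have "coprime (2 * q) 47"
    by simp
  then have "coprime (int (2 * q)) M"
    unfolding M_def by (metis coprime_int_iff coprime_power_right_iff of_nat_numeral)
  then obtain x where x: "[int (2 * q) * x = 1] (mod M)"
    using cong_solve_coprime_int by blast
  \<comment> \<open>\<open>u\<close> is prime to \<open>47\<close> and \<open>u / M\<close> lies in the window\<close>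
  define u :: int where "u = 12 * 47 ^ e + 1"
  have "[int (2 * q) * x * u = 1 * u] (mod M)"
    using x by (intro cong_mult) auto
  then obtain m where m: "int (2 * q) * x * u = u + M * m"
    by (metis cong_iff_lin cong_sym mult_1)
  have u47: "\<not> 47 dvd u"
  proof (cases e)
    case 0
    then show ?thesis by (simp add: u_def)
  next
    case (Suc n)
    then have "u = 47 * (12 * 47 ^ n) + 1" by (simp add: u_def)
    then show ?thesis by presburger
  qed
  have M: "47 dvd M" by (simp add: M_def)
  have xu: "\<not> 47 dvd x * u"
  proof
    assume "47 dvd x * u"
    then have "47 dvd u + M * m" 
      unfolding m[symmetric] by (simp add: mult.assoc)
    with M u47 show False by (simp add: dvd_add_left_iff)
  qed
  define j where "j = int p' * (x * u)"
  have "\<not> 47 dvd j"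
  proof -
    have "prime (47::int)" by (simp add: prime_int_numeral_eq)
    moreover have "\<not> 47 dvd int p'"
      using p' by presburger
    ultimately show ?thesis
      using xu unfolding j_def by (simp add: prime_dvd_mult_iff)
  qed
  moreover have "2 * of_int j / (47 * s) = of_int u / of_int M + of_int m"
  proof -
    have "2 * of_int j / (47 * s) = of_int (int (2 * q) * x * u) / real_of_int M"
      using \<open>p \<noteq> 0\<close> assms(3) p by (simp add: assms(2) j_def M_def field_simps)
    also have "\<dots> = of_int u / of_int M + of_int m"
      unfolding m by (simp add: M_def field_simps)
    finally show ?thesis .
  qed
  then have "frac (2 * of_int j / (47 * s)) = frac (real_of_int u / of_int M)"
    by simp
  moreover have "(1::real) \<le> 47 ^ e" by simp
  then have w: "12 / 47 \<le> real_of_int u / of_int M" "real_of_int u / of_int M \<le> 35 / 47"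
    by (simp_all add: u_def M_def field_simps del: one_le_power)
  then have "frac (real_of_int u / of_int M) = real_of_int u / of_int M"
    by (subst frac_eq) linarith
  ultimately show ?thesis
    using w assms(1) by (intro admissible_scale_exact[of s j]) simp_all
qed

text \<open>Some \<open>j\<close> prime to 47 lies in \<open>[6 * s, 6 * s + 2]\<close>, so
  \<open>2 * j / (47 * s)\<close> exceeds 12/47 by at most \<open>4 / (47 * s)\<close>, hence by at
  most 2/47.\<close>

lemma admissible_scale_large:
  assumes "s \<ge> 2"
  shows "\<exists>\<mu>. admissible_scale s \<mu>"
proof -
  define i where "i = \<lceil>6 * s\<rceil>"
  define j where "j = (if 47 dvd i then i + 1 else i)"
  have "\<not> 47 dvd j"
    unfolding j_def by presburger
  moreover have "6 * s \<le> of_int i" "of_int i \<le> 6 * s + 1"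
    unfolding i_def using ceiling_correct[of "6 * s"] by linarith+
  then have "6 * s \<le> of_int j" "of_int j \<le> 6 * s + 2"
    by (auto simp: j_def)
  then have w: "12 / 47 \<le> 2 * of_int j / (47 * s)" "2 * of_int j / (47 * s) \<le> 35 / 47"
    using assms by (simp_all add: field_simps)
  moreover have "frac (2 * of_int j / (47 * s)) = 2 * of_int j / (47 * s)"
    using w by (subst frac_eq) linarith
  ultimately show ?thesis
    using assms by (intro admissible_scale_exact[of s j]) simp_all
qed

text \<open>The ideal value \<open>h\<close> of \<open>2 * \<mu>\<close> makes
  \<open>47 * \<mu> * s\<close> equal to 1. Clamping its fractional part into the window moves it by
  at most 12/47, hence the product by at most \<open>6 * s\<close>, which is within
  tolerance.\<close>

lemma admissible_scale_small:
  assumes "s > 0" "s \<le> 1 / (7 * 47 ^ 4 * 48)"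
  shows "\<exists>\<mu>. admissible_scale s \<mu>"
proof -
  define h where "h = 2 / (47 * s)"
  define w where "w = max (12 / 47) (min (35 / 47) (frac h))"
  define \<mu> where "\<mu> = (w + of_int \<lfloor>h\<rfloor>) / 2"
  have w: "12 / 47 \<le> w" "w \<le> 35 / 47" by (simp_all add: w_def)
  have \<mu>: "2 * \<mu> = w + of_int \<lfloor>h\<rfloor>" by (simp add: \<mu>_def)
  have "frac (2 * \<mu>) = w"
    unfolding \<mu> using w by (simp add: frac_eq)
  have "\<bar>w - frac h\<bar> \<le> 12 / 47"
    using frac_ge_0[of h] frac_lt_1[of h] unfolding w_def by (auto simp: max_def min_def abs_le_iff)
  moreover have "2 * \<mu> - h = w - frac h"
    unfolding \<mu> frac_def by simp
  ultimately have "\<bar>2 * \<mu> - h\<bar> \<le> 12 / 47"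
    by simp
  then have "\<bar>2 * \<mu> - h\<bar> * \<bar>47 * s / 2\<bar> \<le> (12 / 47) * \<bar>47 * s / 2\<bar>"
    by (rule mult_right_mono) simp
  moreover have "47 * \<mu> * s - of_int 1 = (2 * \<mu> - h) * (47 * s / 2)"
    using assms(1) by (simp add: h_def field_simps)
  ultimately have "\<bar>47 * \<mu> * s - of_int 1\<bar> \<le> (12 / 47) * (47 * s / 2)"
    using assms(1) by (simp only: abs_mult)
  also have "\<dots> \<le> 1 / (8 * 7 * 47 ^ 4)"
    using assms(2) by simp
  finally show ?thesis
    using w \<open>frac (2 * \<mu>) = w\<close> unfolding admissible_scale_def
    by (intro exI[of _ \<mu>] conjI exI[of _ 1]) simp_all
qed

theorem theorem2:
  fixes \<alpha> :: real
  assumes "\<alpha> > 0"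
    and "\<alpha>\<^sup>2 \<notin> \<rat>
       \<or> (\<exists>p q :: nat. q > 0 \<and> \<alpha>\<^sup>2 = real p / real q \<and> \<not> 47 dvd q)
       \<or> \<alpha>\<^sup>2 \<ge> 2
       \<or> \<alpha>\<^sup>2 \<le> 1 / (7 * 47 ^ 4 * 48)"
  shows "\<exists>c :: real ^ ('n::finite) \<Rightarrow> colour.
           \<not> has_mono_copy c Red 1 3 \<and> \<not> has_mono_copy c Blue \<alpha> 8649"
proof -
  have "\<alpha>\<^sup>2 > 0" using assms(1) by simp
  then have "\<exists>\<mu>. admissible_scale (\<alpha>\<^sup>2) \<mu>"
    using assms(2) admissible_scale_irrational admissible_scale_rational
      admissible_scale_large admissible_scale_small by blast
  then show ?thesis
    using colouring_from_admissible_scale assms(1) by blast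
qed

end
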